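(* Let the consequence space be $\mathcal{C}=[0,\infty]$ with its natural order $\ge$. Let $\varepsilon$ be a valid E-capacity kernel for a hypothesis class $\mathcal{H}$ on $\mathcal{P}$. Suppose that $P\mapsto L_P$ is $\mathcal{H}$-order-measurable. Assume that $\mathcal{D}$ is at most countable and that, for every $d\in\mathcal{D}$, the map $x\mapsto\int^E L_P(d)\,d\varepsilon(P\mid x)$ is $\Sigma$-measurable. Then, for every $P\in\mathcal{P}$, $$\mathbb{E}^P\left[\sup_{d\in\mathcal{D}}\frac{L_P(d)}{\int^E L_{P'}(d)\,d\varepsilon(P'\mid X)}\right]\le1.$$
   Context: $(\mathcal{X},\Sigma)$ is a measurable space and $\mathcal{P}$ a collection of probability measures on it. A hypothesis class on a set is a collection of subsets closed under arbitrary unions (including the empty union, so it contains $\emptyset$). An E-capacity for $\mathcal{H}$ is a map $\varepsilon:\mathcal{H}\to[0,\infty]$ with $\varepsilon(\emptyset)=\infty$ and $\varepsilon(H')\le\varepsilon(H)$ whenever $H\subseteq H'$, $H,H'\in\mathcal{H}$. An E-capacity kernel is a map $\varepsilon:\mathcal{H}\times\mathcal{X}\to[0,\infty]$, written $\varepsilon(H\mid x)$, with $x\mapsto\varepsilon(H\mid x)$ $\Sigma$-measurable for every $H\in\mathcal{H}$ and $H\mapsto\varepsilon(H\mid x)$ an E-capacity for every $x$. It is valid if $\mathbb{E}^P[\varepsilon(H\mid X)]\le1$ for every nonempty $H\in\mathcal{H}$ and every $P\in H$, where $\mathbb{E}^P$ is expectation when $X$ has law $P$. Decision setting: $\mathcal{D}$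 is a set of decisions; for each $P\in\mathcal{P}$ there is a loss function $L_P:\mathcal{D}\to[0,\infty]$, and $\mathcal{L}=\{L_P:P\in\mathcal{P}\}$. Define the preorder $\ell\succsim_{\mathcal{L}}\ell'$ on $\mathcal{L}$ by $\ell(d)\ge\ell'(d)$ for every $d\in\mathcal{D}$, and let $\mathcal{H}_{\succsim_{\mathcal{L}}}$ be the smallest union-closed collection of subsets of $\mathcal{L}$ containing all $U_\ell=\{\ell'\in\mathcal{L}:\ell'\succsim_{\mathcal{L}}\ell\}$, $\ell\in\mathcal{L}$. The map $P\mapsto L_P$ is $\mathcal{H}$-order-measurable if $\{P\in\mathcal{P}:L_P\in A\}\in\mathcal{H}$ for every $A\in\mathcal{H}_{\succsim_{\mathcal{L}}}$. (Then $\{P\in\mathcal{P}:L_P(d)\ge c\}\in\mathcal{H}$ for all $d\in\mathcal{D}$, $c\in[0,\infty]$.) The E-integral of $f:\mathcal{P}\to[0,\infty]$ with $\{f\ge c\}\in\mathcal{H}$ for all $c>0$, with respect to a map $\eta:\mathcal{H}\to[0,\infty]$ with $\eta(\emptyset)=\infty$, is $\int^E f\,d\eta=\sup_{c>0}c/\eta(\{f\ge c\})$. Thus $\int^E L_P(d)\,d\varepsilon(P\mid x)=\sup_{c>0}c/\varepsilon(\{P\in\mathcal{P}:L_P(d)\ge c\}\mid x)$. Conventions: $c/0=\infty$ and $c/\infty=0$ for $c\in(0,\infty]$, $0/0=0$, $0\cdot\infty=0$, $\sup\emptyset=0$. *)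

theory Defs
  imports "HOL-Probability.Probability"
begin

definition hypothesis_class :: "'a set \<Rightarrow> 'a set set \<Rightarrow> bool" where
  "hypothesis_class \<Omega> \<H> \<longleftrightarrow> \<H> \<subseteq> Pow \<Omega> \<and> (\<forall>\<A>\<subseteq>\<H>. \<Union>\<A> \<in> \<H>)"

definition E_capacity :: "'a set set \<Rightarrow> ('a set \<Rightarrow> ennreal) \<Rightarrow> bool" where
  "E_capacity \<H> \<epsilon> \<longleftrightarrow>
     \<epsilon> {} = \<infinity> \<and> (\<forall>H\<in>\<H>. \<forall>H'\<in>\<H>. H \<subseteq> H' \<longrightarrow> \<epsilon> H' \<le> \<epsilon> H)"

text \<open>Only \<^term>\<open>space M\<close> and \<^term>\<open>sets M\<close> matter below: \<open>M\<close> stands for the measurable space,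
  and \<open>\<epsilon> H x\<close> for the value of the kernel at \<open>H\<close> given \<open>x\<close>.\<close>

definition E_capacity_kernel ::
    "'x measure \<Rightarrow> 'a set set \<Rightarrow> ('a set \<Rightarrow> 'x \<Rightarrow> ennreal) \<Rightarrow> bool" where
  "E_capacity_kernel M \<H> \<epsilon> \<longleftrightarrow>
     (\<forall>H\<in>\<H>. \<epsilon> H \<in> borel_measurable M) \<and>
     (\<forall>x\<in>space M. E_capacity \<H> (\<lambda>H. \<epsilon> H x))"

definition valid_kernel ::
    "'x measure set set \<Rightarrow> ('x measure set \<Rightarrow> 'x \<Rightarrow> ennreal) \<Rightarrow> bool" where
  "valid_kernel \<H> \<epsilon> \<longleftrightarrow>
     (\<forall>H\<in>\<H>. H \<noteq> {} \<longrightarrow> (\<forall>P\<in>H. (\<integral>\<^sup>+x. \<epsilon> H x \<partial>P) \<le> 1))"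

text \<open>The threshold \<open>c\<close> ranges over all of \<open>(0, \<infinity>]\<close>.  Division on \<^typ>\<open>ennreal\<close> satisfies
  \<open>c / 0 = \<infinity>\<close> and \<open>c / \<infinity> = 0\<close> for \<open>c\<close> in \<open>(0, \<infinity>]\<close> (so \<open>\<infinity> / \<infinity> = 0\<close>), as well as \<open>0 / 0 = 0\<close>;
  the supremum of the empty set is \<open>0\<close>.\<close>

definition E_integral :: "'a set \<Rightarrow> ('a \<Rightarrow> ennreal) \<Rightarrow> ('a set \<Rightarrow> ennreal) \<Rightarrow> ennreal" where
  "E_integral \<Omega> f \<eta> = (SUP c\<in>{0<..}. c / \<eta> {p \<in> \<Omega>. f p \<ge> c})"

text \<open>Losses are functions on the decision set \<open>D\<close> only, so they are restricted to \<open>D\<close> before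
  being collected.\<close>

definition loss_class :: "'p set \<Rightarrow> 'd set \<Rightarrow> ('p \<Rightarrow> 'd \<Rightarrow> ennreal) \<Rightarrow> ('d \<Rightarrow> ennreal) set" where
  "loss_class \<P> D L = (\<lambda>P. restrict (L P) D) ` \<P>"

definition loss_ge :: "'d set \<Rightarrow> ('d \<Rightarrow> ennreal) \<Rightarrow> ('d \<Rightarrow> ennreal) \<Rightarrow> bool" where
  "loss_ge D l l' \<longleftrightarrow> (\<forall>d\<in>D. l d \<ge> l' d)"

definition loss_upset ::
    "'d set \<Rightarrow> ('d \<Rightarrow> ennreal) set \<Rightarrow> ('d \<Rightarrow> ennreal) \<Rightarrow> ('d \<Rightarrow> ennreal) set" where
  "loss_upset D \<L> l = {l' \<in> \<L>. loss_ge D l' l}"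

definition order_hypotheses ::
    "'d set \<Rightarrow> ('d \<Rightarrow> ennreal) set \<Rightarrow> ('d \<Rightarrow> ennreal) set set" where
  "order_hypotheses D \<L> = hypothesis_class \<L> hull (loss_upset D \<L> ` \<L>)"

definition order_measurable ::
    "'p set \<Rightarrow> 'p set set \<Rightarrow> 'd set \<Rightarrow> ('p \<Rightarrow> 'd \<Rightarrow> ennreal) \<Rightarrow> bool" where
  "order_measurable \<P> \<H> D L \<longleftrightarrow>
     (\<forall>A\<in>order_hypotheses D (loss_class \<P> D L). {P \<in> \<P>. restrict (L P) D \<in> A} \<in> \<H>)"

lemma hypothesis_class_order_hypotheses: "hypothesis_class \<L> (order_hypotheses D \<L>)"
proof -
  have "hypothesis_class \<L> (Pow \<L>)"
    by (auto simp: hypothesis_class_def)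
  moreover have "loss_upset D \<L> ` \<L> \<subseteq> Pow \<L>"
    by (auto simp: loss_upset_def)
  ultimately have 1: "order_hypotheses D \<L> \<subseteq> Pow \<L>"
    unfolding order_hypotheses_def by (rule hull_minimal[rotated])
  have 2: "\<Union>\<A> \<in> order_hypotheses D \<L>" if "\<A> \<subseteq> order_hypotheses D \<L>" for \<A>
    unfolding order_hypotheses_def hull_def
  proof (rule InterI, clarify)
    fix T assume T: "hypothesis_class \<L> T" "loss_upset D \<L> ` \<L> \<subseteq> T"
    then have "order_hypotheses D \<L> \<subseteq> T"
      unfolding order_hypotheses_def by (intro hull_minimal)
    with that T(1) show "\<Union>\<A> \<in> T"
      by (auto simp: hypothesis_class_def)
  qed
  from 1 2 show ?thesis
    unfolding hypothesis_class_def by blast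
qed

lemma order_measurable_superlevel:
  assumes "order_measurable \<P> \<H> D L" and "d \<in> D"
  shows "{P \<in> \<P>. L P d \<ge> c} \<in> \<H>"
proof -
  define \<L> where "\<L> = loss_class \<P> D L"
  define A where "A = \<Union>(loss_upset D \<L> ` {l \<in> \<L>. l d \<ge> c})"
  have "loss_upset D \<L> ` \<L> \<subseteq> order_hypotheses D \<L>"
    unfolding order_hypotheses_def by (rule hull_subset)
  then have "loss_upset D \<L> ` {l \<in> \<L>. l d \<ge> c} \<subseteq> order_hypotheses D \<L>"
    by blast
  then have "A \<in> order_hypotheses D \<L>"
    using hypothesis_class_order_hypotheses[of \<L> D] unfolding A_def hypothesis_class_def by blast
  moreover have "{l \<in> \<L>. l d \<ge> c} = A"
    using \<open>d \<in> D\<close> unfolding A_def loss_upset_def loss_ge_def by (fastforce intro: order_trans)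
  ultimately have "{P \<in> \<P>. restrict (L P) D \<in> {l \<in> \<L>. l d \<ge> c}} \<in> \<H>"
    using assms(1) unfolding order_measurable_def \<L>_def by blast
  moreover have "{P \<in> \<P>. restrict (L P) D \<in> {l \<in> \<L>. l d \<ge> c}} = {P \<in> \<P>. L P d \<ge> c}"
    using \<open>d \<in> D\<close> by (auto simp: \<L>_def loss_class_def)
  ultimately show ?thesis
    by simp
qed

end

theory Submission
  imports Defs
begin

text \<open>The set \<open>U\<close> of all \<open>P'\<close> whose loss dominates that of \<open>P\<close> at every decision is a hypothesis
  containing \<open>P\<close>, and it is contained in each superlevel set \<open>{P'. L P' d \<ge> L P d}\<close>. Evaluating
  the supremum in the E-integral at the threshold \<open>L P d\<close> therefore bounds every ratio by
  \<open>\<epsilon> U x\<close>, uniformly in \<open>d\<close>, and validity at \<open>U\<close> finishes the proof.\<close>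

lemma divide_left_antimono_ennreal:
  fixes a b c :: ennreal
  assumes "a \<le> b"
  shows "c / b \<le> c / a"
proof -
  have "inverse b \<le> inverse a"
    including ennreal.lifting using assms by transfer (rule ereal_inverse_antimono)
  then show ?thesis
    unfolding divide_ennreal_def by (intro mult_left_mono) auto
qed

text \<open>Equality holds for \<open>0 < c < top\<close>. At \<open>c = 0\<close> the left side is
  \<open>0\<close>, and for \<open>c = top\<close> with finite \<open>e\<close> it is
  \<open>top / top = 0\<close>, so in general only the inequality survives.\<close>

lemma divide_divide_le_ennreal:
  fixes c e :: ennreal
  shows "c / (c / e) \<le> e"
proof (cases c)
  case (real r)
  show ?thesis
  proof (cases e)
    case (real s)
    show ?thesis
    proof (cases "r = 0 \<or> s = 0")
      case True
      then show ?thesis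
        using \<open>c = ennreal r\<close> \<open>e = ennreal s\<close> by (cases "r = 0") simp_all
    next
      case False
      then show ?thesis
        using \<open>c = ennreal r\<close> \<open>e = ennreal s\<close> \<open>0 \<le> r\<close> \<open>0 \<le> s\<close>
        by (simp add: divide_ennreal less_le)
    qed
  qed simp
next
  case top
  then show ?thesis
    by (cases "e = top") (simp_all add: ennreal_top_divide)
qed

text \<open>This is Markov's inequality for the E-integral at the level \<open>f P\<close>, solved
  for the value of \<open>\<eta>\<close> on the superlevel set.\<close>

lemma divide_E_integral_le:
  assumes "P \<in> \<Omega>"
  shows "f P / E_integral \<Omega> f \<eta> \<le> \<eta> {p \<in> \<Omega>. f p \<ge> f P}"
proof (cases "f P = 0")
  \<comment> \<open>Thresholds are strictly positive, so \<open>f P\<close> is admissible only in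
    this case; for \<open>f P = 0\<close> the ratio is \<open>0\<close>.\<close>
  case False
  let ?e = "\<eta> {p \<in> \<Omega>. f p \<ge> f P}"
  have "f P / ?e \<le> E_integral \<Omega> f \<eta>"
    unfolding E_integral_def using False by (intro SUP_upper) (simp add: zero_less_iff_neq_zero)
  then have "f P / E_integral \<Omega> f \<eta> \<le> f P / (f P / ?e)"
    by (rule divide_left_antimono_ennreal)
  also have "\<dots> \<le> ?e"
    by (rule divide_divide_le_ennreal)
  finally show ?thesis .
qed simp

text \<open>The set is the preimage of a principal up-set, one of the generators of the order
  hypotheses. Intersecting superlevel sets over \<open>D\<close> would not do, since a hypothesis
  class need only be closed under unions.\<close>

lemma order_measurable_upset:
  assumes "order_measurable \<P> \<H> D L" and "P \<in> \<P>"
  shows "{P' \<in> \<P>. \<forall>d\<in>D. L P' d \<ge> L P d} \<in> \<H>"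
proof -
  let ?\<L> = "loss_class \<P> D L"
  let ?A = "loss_upset D ?\<L> (restrict (L P) D)"
  have "restrict (L P) D \<in> ?\<L>"
    using assms(2) by (auto simp: loss_class_def)
  then have "?A \<in> loss_upset D ?\<L> ` ?\<L>"
    by (rule imageI)
  then have "?A \<in> order_hypotheses D ?\<L>"
    unfolding order_hypotheses_def by (rule hull_inc)
  with assms(1) have "{P' \<in> \<P>. restrict (L P') D \<in> ?A} \<in> \<H>"
    unfolding order_measurable_def by blast
  also have "{P' \<in> \<P>. restrict (L P') D \<in> ?A} = {P' \<in> \<P>. \<forall>d\<in>D. L P' d \<ge> L P d}"
    by (auto simp: loss_upset_def loss_ge_def loss_class_def)
  finally show ?thesis .
qed

theorem theorem5:
  fixes M :: "'x measure"
    and \<P> :: "'x measure set"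
    and \<H> :: "'x measure set set"
    and \<epsilon> :: "'x measure set \<Rightarrow> 'x \<Rightarrow> ennreal"
    and D :: "'d set"
    and L :: "'x measure \<Rightarrow> 'd \<Rightarrow> ennreal"
  assumes "\<And>P. P \<in> \<P> \<Longrightarrow> prob_space P \<and> sets P = sets M"
    and "hypothesis_class \<P> \<H>"
    and "E_capacity_kernel M \<H> \<epsilon>"
    and "valid_kernel \<H> \<epsilon>"
    and "order_measurable \<P> \<H> D L"
    and "countable D"
    and "\<And>d. d \<in> D \<Longrightarrow>
           (\<lambda>x. E_integral \<P> (\<lambda>P. L P d) (\<lambda>H. \<epsilon> H x)) \<in> borel_measurable M"
  shows "\<forall>P\<in>\<P>. (\<integral>\<^sup>+x. (SUP d\<in>D. L P d / E_integral \<P> (\<lambda>P'. L P' d) (\<lambda>H. \<epsilon> H x)) \<partial>P) \<le> 1"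
proof
  fix P assume P: "P \<in> \<P>"
  let ?U = "{P' \<in> \<P>. \<forall>d\<in>D. L P' d \<ge> L P d}"
  have U: "?U \<in> \<H>"
    using assms(5) P by (rule order_measurable_upset)
  have "(SUP d\<in>D. L P d / E_integral \<P> (\<lambda>P'. L P' d) (\<lambda>H. \<epsilon> H x)) \<le> \<epsilon> ?U x"
    if "x \<in> space P" for x
  proof (rule SUP_least)
    fix d assume d: "d \<in> D"
    let ?H = "{P' \<in> \<P>. L P' d \<ge> L P d}"
    have "x \<in> space M"
      using that assms(1)[OF P] sets_eq_imp_space_eq[of P M] by simp
    then have cap: "E_capacity \<H> (\<lambda>H. \<epsilon> H x)"
      using assms(3) by (simp add: E_capacity_kernel_def)
    have H: "?H \<in> \<H>"
      using assms(5) d by (rule order_measurable_superlevel)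
    have "L P d / E_integral \<P> (\<lambda>P'. L P' d) (\<lambda>H. \<epsilon> H x) \<le> \<epsilon> ?H x"
      using P by (rule divide_E_integral_le[where f = "\<lambda>P'. L P' d" and \<eta> = "\<lambda>H. \<epsilon> H x"])
    \<comment> \<open>Capacities are antitone: passing to the smaller set \<open>?U\<close> can only
      raise the value, and it removes the dependence on \<open>d\<close>.\<close>
    also have "\<epsilon> ?H x \<le> \<epsilon> ?U x"
    proof -
      have "?U \<subseteq> ?H"
        using d by blast
      with cap U H show ?thesis
        unfolding E_capacity_def by blast
    qed
    finally show "L P d / E_integral \<P> (\<lambda>P'. L P' d) (\<lambda>H. \<epsilon> H x) \<le> \<epsilon> ?U x" .
  qed
  then have "(\<integral>\<^sup>+x. (SUP d\<in>D. L P d / E_integral \<P> (\<lambda>P'. L P' d) (\<lambda>H. \<epsilon> H x)) \<partial>P)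
      \<le> (\<integral>\<^sup>+x. \<epsilon> ?U x \<partial>P)"
    by (rule nn_integral_mono)
  also have "\<dots> \<le> 1"
  proof -
    \<comment> \<open>Reflexivity of the order puts \<open>P\<close> in \<open>?U\<close>, so
      validity at \<open>?U\<close> bounds the expectation under \<open>P\<close> itself.\<close>
    have "P \<in> ?U"
      using P by simp
    moreover from this have "?U \<noteq> {}"
      by (metis empty_iff)
    ultimately show ?thesis
      using assms(4)[unfolded valid_kernel_def, rule_format, OF U] by simp
  qed
  finally show "(\<integral>\<^sup>+x. (SUP d\<in>D. L P d / E_integral \<P> (\<lambda>P'. L P' d) (\<lambda>H. \<epsilon> H x)) \<partial>P) \<le> 1" .
qed

end
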